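(* Let $0<\alpha<1$ and let $\omega_n=\frac{1}{\Gamma(\alpha+1)}\{(n+1)^\alpha-n^\alpha\}$ for $n=0,1,\dots$. Let $\sum_{n=0}^\infty\omega_n^{(-1)}\xi^n$ be the inverse, with respect to multiplication of formal power series, of $\omega(\xi)=\sum_{n=0}^\infty\omega_n\xi^n$. Then $$\omega_0^{(-1)}>0,\qquad \omega_n^{(-1)}<0\quad\text{for } n=1,2,\dots,$$ $$\omega_0^{(-1)}=\Gamma(\alpha+1)=\sum_{n=1}^\infty|\omega_n^{(-1)}|,$$ $$\omega_n^{(-1)}=O(n^{-\alpha-1})\quad\text{as }n\to\infty.$$
   Context: $\Gamma$ denotes Euler's gamma function; $0^\alpha=0$. *)

theory Defs
  imports
    "HOL-Analysis.Analysis"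
    "HOL-Computational_Algebra.Formal_Power_Series"
    "HOL-Library.Landau_Symbols"
begin

(* powr satisfies 0 powr \<alpha> = 0, so the convention for n = 0 needs no special case. *)
definition omega :: "real \<Rightarrow> nat \<Rightarrow> real" where
  "omega \<alpha> n = (1 / Gamma (\<alpha> + 1)) * ((real n + 1) powr \<alpha> - real n powr \<alpha>)"

definition omega_inv :: "real \<Rightarrow> nat \<Rightarrow> real" where
  "omega_inv \<alpha> n = fps_nth (inverse (Abs_fps (omega \<alpha>))) n"

(* The library's inverse of a formal power series is a genuine multiplicative inverse
   only when the constant coefficient is nonzero, as it is here. *)
lemma omega_inv_mult:
  assumes "0 < \<alpha>"
  shows "Abs_fps (omega \<alpha>) * Abs_fps (omega_inv \<alpha>) = 1"
proof -
  have "Gamma (\<alpha> + 1) \<noteq> 0"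
    using Gamma_real_pos[of "\<alpha> + 1"] assms by linarith
  then have "fps_nth (Abs_fps (omega \<alpha>)) 0 \<noteq> 0"
    by (simp add: omega_def)
  moreover have "Abs_fps (omega_inv \<alpha>) = inverse (Abs_fps (omega \<alpha>))"
    by (simp add: fps_eq_iff omega_inv_def)
  ultimately show ?thesis
    by (metis inverse_mult_eq_1 mult.commute)
qed

end

(* After scaling, a_n = (n+1)^alpha - n^alpha is a Hausdorff moment sequence: the functional
   L(x^n) = a_n is nonnegative on polynomials that are nonnegative on (0,1), because
   s |-> L_s(x^n) = (n+s)^alpha has derivative alpha (n+s)^(alpha-1), an integral of
   exp(-(n+s)t) against t^(-alpha). Let b be the reciprocal series of a and
   q_n = sum_k b_k x^(n-k). Multiplication by x sends q_n to q_(n+1) up to a constant and L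
   annihilates q_n for n > 0, so L(q_n q_m) = -b_(n+m) for n, m > 0 and
   L(x q_n q_m) = -b_(n+m+1). Positivity of L on squares times 1, x, 1 - x and x(1 - x) then
   shows that -b_n is nonnegative and decreasing for n > 0. The partial sums r_n of b satisfy
   sum_k r_k a_(n-k) = 1 and decrease, hence r_n <= (n+1)^(-alpha); together with the
   monotonicity of b this gives both the sum and the decay rate. If some b_n vanished, so would
   all later r_k, and a_n -> 0 would contradict the convolution identity. *)

theory Submission
  imports Defs "HOL-Real_Asymp.Real_Asymp"
begin

section \<open>The linear functional on polynomials attached to a sequence\<close>

definition moment_functional :: "(nat \<Rightarrow> real) \<Rightarrow> real poly \<Rightarrow> real" where
  "moment_functional a p = (\<Sum>k\<le>degree p. coeff p k * a k)"

lemma moment_functional_altdef: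
  assumes "degree p \<le> N"
  shows "moment_functional a p = (\<Sum>k\<le>N. coeff p k * a k)"
  unfolding moment_functional_def
  using assms by (intro sum.mono_neutral_left) (auto simp: coeff_eq_0)

lemma moment_functional_add:
  "moment_functional a (p + q) = moment_functional a p + moment_functional a q"
proof -
  define N where "N = max (degree p) (degree q)"
  have "degree p \<le> N" "degree q \<le> N" "degree (p + q) \<le> N"
    by (auto simp: N_def intro: degree_add_le)
  then show ?thesis
    by (simp add: moment_functional_altdef[of _ N] algebra_simps sum.distrib)
qed

lemma moment_functional_smult:
  "moment_functional a (smult c p) = c * moment_functional a p"
  by (simp add: moment_functional_altdef[of _ "degree p"] degree_smult_le sum_distrib_left
      mult.assoc)

lemma moment_functional_diff:
  "moment_functional a (p - q) = moment_functional a p - moment_functional a q"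
  using moment_functional_add[of a p "smult (-1) q"] moment_functional_smult[of a "-1" q] by simp

text \<open>Multiplication by x turns into a shift of \<open>a\<close>; this is how the functional
  is evaluated along the recursion of \<open>q\<close>.\<close>

lemma moment_functional_pCons:
  "moment_functional a (pCons c p) = c * a 0 + moment_functional (\<lambda>n. a (Suc n)) p"
proof -
  have "moment_functional a (pCons c p) =
      (\<Sum>k\<le>Suc (degree p). coeff (pCons c p) k * a k)"
    by (rule moment_functional_altdef) (rule degree_pCons_le)
  then show ?thesis
    by (simp add: sum.atMost_Suc_shift moment_functional_def del: sum.atMost_Suc)
qed

lemma moment_functional_0 [simp]: "moment_functional a 0 = 0"
  by (simp add: moment_functional_def)

section \<open>Reciprocal of a Hausdorff moment series: sign and monotonicity\<close>

locale hausdorff_moments =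
  fixes a :: "nat \<Rightarrow> real"
  assumes a_0: "a 0 = 1"
  assumes moment_nonneg:
    "(\<And>x. 0 < x \<Longrightarrow> x < 1 \<Longrightarrow> 0 \<le> poly p x) \<Longrightarrow> 0 \<le> moment_functional a p"
begin

definition b :: "nat \<Rightarrow> real" where
  "b n = fps_nth (inverse (Abs_fps a)) n"

text \<open>Horner form of sum_k b_k x^(n-k); the leading coefficient 1 is
  \<open>b 0\<close>.\<close>

primrec q :: "nat \<Rightarrow> real poly" where
  "q 0 = 1"
| "q (Suc n) = pCons (b (Suc n)) (q n)"

lemma b_0: "b 0 = 1"
  by (simp add: b_def a_0)

lemma convolution: "(\<Sum>k\<le>n. b k * a (n - k)) = (if n = 0 then 1 else 0)"
proof -
  have "inverse (Abs_fps a) * Abs_fps a = 1"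
    by (rule inverse_mult_eq_1) (simp add: a_0)
  then have "fps_nth (inverse (Abs_fps a) * Abs_fps a) n = fps_nth 1 n"
    by simp
  then show ?thesis
    by (simp add: fps_mult_nth b_def atMost_atLeast0)
qed

text \<open>Each \<open>pCons\<close> shifts the sequence by one, so the induction has to run over
  all shifts \<open>j\<close>; for \<open>j = 0\<close> the right side is the convolution.\<close>

lemma moment_q_shift:
  "moment_functional (\<lambda>i. a (i + j)) (q n) = (\<Sum>k\<le>n. b k * a (n - k + j))"
proof (induction n arbitrary: j)
  case 0
  show ?case by (simp add: b_0 one_pCons moment_functional_pCons)
next
  case (Suc n)
  have "(\<Sum>k\<le>n. b k * a (n - k + Suc j)) = (\<Sum>k\<le>n. b k * a (Suc n - k + j))"
    by (intro sum.cong) (auto simp: Suc_diff_le)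
  then show ?case
    using Suc.IH[of "Suc j"] by (simp add: moment_functional_pCons)
qed

lemma moment_q: "moment_functional a (q n) = (if n = 0 then 1 else 0)"
  using moment_q_shift[of 0 n] convolution[of n] by simp

lemma moment_x_q: "moment_functional a (pCons 0 (q n)) = - b (Suc n)"
  using moment_q[of "Suc n"] moment_functional_add[of a "[:b (Suc n):]" "pCons 0 (q n)"]
  by (simp add: moment_functional_pCons a_0)

lemma q_Suc_mult: "q (Suc n) * p = pCons 0 (q n * p) + smult (b (Suc n)) p"
  by simp

text \<open>The product \<open>q (Suc n) * q (Suc m)\<close> can be reduced in either factor; what
  is left over is a constant multiple of the other factor, which the functional annihilates.
  Comparing the two reductions moves one unit of index from \<open>m\<close> to \<open>n\<close>,
  down to \<open>m = 0\<close>.\<close>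

lemma moment_x_q_mult: "moment_functional a (pCons 0 (q n * q m)) = - b (Suc (n + m))"
proof (induction m arbitrary: n)
  case 0
  then show ?case by (simp add: moment_x_q)
next
  case (Suc m)
  let ?L = "moment_functional a"
  have "?L (q (Suc n) * q (Suc m)) = ?L (pCons 0 (q n * q (Suc m)))"
    unfolding q_Suc_mult[of n] by (simp add: moment_functional_add moment_functional_smult moment_q
        del: q.simps)
  moreover have "?L (q (Suc m) * q (Suc n)) = ?L (pCons 0 (q m * q (Suc n)))"
    unfolding q_Suc_mult[of m] by (simp add: moment_functional_add moment_functional_smult moment_q
        del: q.simps)
  ultimately show ?case
    using Suc.IH[of "Suc n"] by (simp add: mult.commute del: q.simps)
qed

lemma moment_q_mult: "moment_functional a (q (Suc n) * q (Suc m)) = - b (Suc n + Suc m)"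
proof -
  have "moment_functional a (q (Suc n) * q (Suc m)) = moment_functional a (pCons 0 (q n * q (Suc m)))"
    unfolding q_Suc_mult[of n] by (simp add: moment_functional_add moment_functional_smult moment_q
        del: q.simps)
  then show ?thesis by (simp add: moment_x_q_mult del: q.simps)
qed

text \<open>The test polynomial is a square for an even index and x times a square for an odd
  one.\<close>

lemma b_nonpos:
  assumes "n \<ge> 1"
  shows "b n \<le> 0"
proof (cases "even n")
  case True
  with assms obtain m where m: "n = Suc m + Suc m"
    by (metis evenE mult_2 not0_implies_Suc add_0 not_one_le_zero)
  have "0 \<le> moment_functional a (q (Suc m) * q (Suc m))"
    by (rule moment_nonneg) (simp del: q.simps)
  then show ?thesis by (simp add: moment_q_mult m del: q.simps)
next
  case False
  then obtain m where m: "n = Suc (m + m)" by (metis oddE mult_2 Suc_eq_plus1)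
  have "0 \<le> moment_functional a (pCons 0 (q m * q m))"
    by (rule moment_nonneg) simp
  then show ?thesis by (simp add: moment_x_q_mult m)
qed

lemma b_Suc_ge:
  assumes "n \<ge> 1"
  shows "b n \<le> b (Suc n)"
proof (cases "even n")
  case True
  with assms obtain m where m: "n = Suc m + Suc m"
    by (metis evenE mult_2 not0_implies_Suc add_0 not_one_le_zero)
  let ?s = "q (Suc m) * q (Suc m)"
  have "0 \<le> moment_functional a (?s - pCons 0 ?s)"
    by (rule moment_nonneg) (simp add: mult_left_le_one_le del: q.simps)
  then show ?thesis
    by (simp add: moment_functional_diff moment_q_mult moment_x_q_mult m del: q.simps)
next
  case False
  then obtain m where m: "n = Suc (m + m)" by (metis oddE mult_2 Suc_eq_plus1)
  let ?x = "pCons 0 (q m)"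
  let ?L = "moment_functional a"
  have "0 \<le> ?L (pCons 0 (q m * q m) - ?x * ?x)"
  proof (rule moment_nonneg)
    fix x :: real assume x: "0 < x" "x < 1"
    have "poly (pCons 0 (q m * q m) - ?x * ?x) x = x * (1 - x) * (poly (q m) x)\<^sup>2"
      by (simp add: algebra_simps power2_eq_square)
    then show "0 \<le> poly (pCons 0 (q m * q m) - ?x * ?x) x" using x by simp
  qed
  then have 1: "?L (?x * ?x) \<le> - b n"
    by (simp only: moment_functional_diff moment_x_q_mult m diff_ge_0_iff_ge)
  have two: "2 * q m = smult 2 (q m)"
    using smult_add_left[of 1 1 "q m"] by simp
  \<comment> \<open>The product formulas do not cover \<open>?x * ?x\<close>, so its value is read
    off from the square of \<open>q (Suc m)\<close>. The cross term contributes -2 b^2 and the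
    constant term b^2, with b = \<open>b (Suc m)\<close>; the net -b^2 has the favourable
    sign.\<close>
  have qS: "q (Suc m) = ?x + smult (b (Suc m)) 1" by simp
  have "q (Suc m) * q (Suc m) = ?x * ?x + smult (2 * b (Suc m)) ?x + smult ((b (Suc m))\<^sup>2) 1"
    unfolding qS by (simp add: algebra_simps power2_eq_square two)
  then have "?L (q (Suc m) * q (Suc m)) = ?L (?x * ?x) + 2 * b (Suc m) * ?L ?x + (b (Suc m))\<^sup>2 * ?L 1"
    by (simp only: moment_functional_add moment_functional_smult)
  moreover have "?L 1 = 1" using moment_q[of 0] by simp
  ultimately have "- b (Suc n) = ?L (?x * ?x) - (b (Suc m))\<^sup>2"
    by (simp add: moment_q_mult moment_x_q m power2_eq_square del: q.simps)
  with 1 show ?thesis using zero_le_power2[of "b (Suc m)"] by linarith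
qed

lemma b_mono:
  assumes "1 \<le> m" "m \<le> n"
  shows "b m \<le> b n"
  using assms(2,1) by (induction rule: dec_induct) (force intro: order_trans[OF _ b_Suc_ge])+

lemma moment_monom: "moment_functional a (monom 1 n) = a n"
  by (subst moment_functional_altdef[of _ n])
    (auto simp: degree_monom_le if_distrib[of "\<lambda>x. x * _"] cong: if_cong)

lemma a_nonneg: "0 \<le> a n"
  using moment_nonneg[of "monom 1 n"] by (simp add: moment_monom poly_monom)

lemma a_Suc_le: "a (Suc n) \<le> a n"
proof -
  have "0 \<le> moment_functional a (monom 1 n - monom 1 (Suc n))"
    by (rule moment_nonneg) (simp add: poly_monom mult_left_le_one_le)
  then show ?thesis by (simp add: moment_functional_diff moment_monom)
qed

section \<open>Partial sums of the reciprocal series\<close>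

definition r :: "nat \<Rightarrow> real" where
  "r n = (\<Sum>k\<le>n. b k)"

lemma r_antimono:
  assumes "m \<le> n"
  shows "r n \<le> r m"
proof -
  have "r (Suc k) \<le> r k" for k
    using b_nonpos[of "Suc k"] by (simp add: r_def)
  then show ?thesis using assms by (rule lift_Suc_antimono_le)
qed

text \<open>For n > 0 the convolution vanishes. Replacing \<open>a (n - k)\<close> by the smaller
  \<open>a n\<close> where \<open>b k\<close> is nonpositive can only raise it, and the result is
  \<open>r n * a n\<close>.\<close>

lemma r_nonneg:
  assumes pos: "0 < a n"
  shows "0 \<le> r n"
proof (cases "n = 0")
  case True
  then show ?thesis by (simp add: r_def b_0)
next
  case False
  have "(\<Sum>k\<le>n. b k * a (n - k)) \<le> (\<Sum>k\<le>n. b k * a n)"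
  proof (rule sum_mono)
    fix k assume k: "k \<in> {..n}"
    show "b k * a (n - k) \<le> b k * a n"
    proof (cases "k = 0")
      case False
      have "a n \<le> a (n - k)"
        by (rule lift_Suc_antimono_le[of a]) (use a_Suc_le in auto)
      then show ?thesis using b_nonpos[of k] False by (intro mult_left_mono_neg) auto
    qed simp
  qed
  then have "0 \<le> r n * a n"
    using False convolution[of n] by (simp add: r_def sum_distrib_right)
  then show ?thesis using pos by (simp add: zero_le_mult_iff)
qed

text \<open>As power series r = b / (1 - x) and a b = 1, so r a = 1 / (1 - x).\<close>

lemma r_convolution: "(\<Sum>k\<le>n. r k * a (n - k)) = 1"
proof (induction n)
  case 0
  show ?case by (simp add: r_def a_0 b_0)
next
  case (Suc n)
  have "(\<Sum>k\<le>Suc n. r k * a (Suc n - k)) = r 0 * a (Suc n) + (\<Sum>k\<le>n. r (Suc k) * a (n - k))"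
    by (simp add: sum.atMost_Suc_shift del: sum.atMost_Suc)
  also have "\<dots> = (b 0 * a (Suc n) + (\<Sum>k\<le>n. b (Suc k) * a (n - k))) + (\<Sum>k\<le>n. r k * a (n - k))"
    by (simp add: r_def algebra_simps sum.distrib)
  also have "b 0 * a (Suc n) + (\<Sum>k\<le>n. b (Suc k) * a (n - k)) = (\<Sum>k\<le>Suc n. b k * a (Suc n - k))"
    by (simp add: sum.atMost_Suc_shift del: sum.atMost_Suc)
  finally show ?case using Suc.IH convolution[of "Suc n"] by simp
qed

text \<open>In the convolution identity each \<open>r k\<close> is at least \<open>r n\<close>, and
  the weights \<open>a (n - k)\<close> are nonnegative.\<close>

lemma r_le:
  assumes "0 < (\<Sum>k\<le>n. a k)"
  shows "r n \<le> 1 / (\<Sum>k\<le>n. a k)"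
proof -
  have "(\<Sum>k\<le>n. r n * a (n - k)) \<le> (\<Sum>k\<le>n. r k * a (n - k))"
    by (intro sum_mono mult_right_mono r_antimono a_nonneg) auto
  moreover have "(\<Sum>k\<le>n. a (n - k)) = (\<Sum>k\<le>n. a k)"
    using sum.atLeastAtMost_rev[of a 0 n] by (simp add: atMost_atLeast0)
  ultimately show ?thesis
    using assms r_convolution[of n] by (simp add: field_simps flip: sum_distrib_left)
qed

lemma b_neg:
  assumes "a \<longlonglongrightarrow> 0" and "r \<longlonglongrightarrow> 0" and n: "n \<ge> 1"
  shows "b n < 0"
proof (rule ccontr)
  assume "\<not> b n < 0"
  then have b0: "b k = 0" if "k \<ge> n" for k
    using b_mono[OF n that] b_nonpos[of k] that n by simp
  have r_const: "r k = r n" if "k \<ge> n" for k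
    using that by (induction rule: dec_induct) (auto simp: r_def b0)
  have "r \<longlonglongrightarrow> r n"
    by (intro tendsto_eventually eventually_sequentiallyI[of n]) (rule r_const)
  with \<open>r \<longlonglongrightarrow> 0\<close> have "r n = 0" using LIMSEQ_unique by blast
  then have r0: "r k = 0" if "k \<ge> n" for k
    using r_const[OF that] by simp
  \<comment> \<open>Only the terms k < n of the convolution at index N + n survive. Each tends to 0
    with \<open>a\<close>, yet their sum is always 1.\<close>
  have "(\<lambda>N. \<Sum>k<n. r k * a (N + n - k)) \<longlonglongrightarrow> (\<Sum>k<n. r k * 0)"
  proof (intro tendsto_intros)
    fix k assume "k \<in> {..<n}"
    then have "(\<lambda>N. a (N + n - k)) = (\<lambda>N. a (N + (n - k)))" by auto
    then show "(\<lambda>N. a (N + n - k)) \<longlonglongrightarrow> 0"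
      using LIMSEQ_ignore_initial_segment[OF assms(1)] by simp
  qed
  moreover have "(\<Sum>k<n. r k * a (N + n - k)) = 1" for N
  proof -
    have "(\<Sum>k<n. r k * a (N + n - k)) = (\<Sum>k\<le>N + n. r k * a (N + n - k))"
      by (rule sum.mono_neutral_left) (auto simp: r0)
    then show ?thesis by (simp add: r_convolution)
  qed
  ultimately show False by (simp add: tendsto_const_iff)
qed

lemma b_sums:
  assumes "r \<longlonglongrightarrow> 0"
  shows "(\<lambda>n. - b (Suc n)) sums 1"
proof -
  have "b sums 0" using assms unfolding r_def sums_def_le .
  then have "(\<lambda>n. b (Suc n)) sums (0 - b 0)" by (simp add: sums_Suc_iff)
  from sums_minus[OF this] show ?thesis by (simp add: b_0)
qed

text \<open>The drop \<open>r m - r n\<close> consists of n - m terms, each at least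
  \<open>- b n\<close> by monotonicity, and \<open>r n\<close> is nonnegative.\<close>

lemma b_tail_bound:
  assumes "m < n" and pos: "0 < a n"
  shows "real (n - m) * - b n \<le> r m"
proof -
  have "r n = r m + (\<Sum>k\<in>{m<..n}. b k)"
  proof -
    have "{..n} = {..m} \<union> {m<..n}" using assms by auto
    then show ?thesis unfolding r_def by (simp add: sum.union_disjoint ivl_disj_int)
  qed
  moreover have "(\<Sum>k\<in>{m<..n}. b k) \<le> (\<Sum>k\<in>{m<..n}. b n)"
    by (intro sum_mono b_mono) auto
  ultimately show ?thesis using r_nonneg[OF pos] by simp
qed

end

section \<open>Laplace integrals and positivity for differences of powers\<close>

lemma has_integral_exp_powr:
  fixes y \<beta> :: real
  assumes "0 < y" "0 < \<beta>"
  shows "((\<lambda>x. exp (- y * x) * x powr (\<beta> - 1)) has_integral Gamma \<beta> / y powr \<beta>) {0..}"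
proof -
  let ?f = "\<lambda>t. t powr (\<beta> - 1) / exp t"
  have "?f absolutely_integrable_on {0..}" "integral {0..} ?f = Gamma \<beta>"
    using Gamma_integral_real[OF assms(2)]
    by (auto simp: has_integral_iff intro!: nonnegative_absolutely_integrable_1)
  moreover have "(*) y ` {0..} = {0..}"
    using assms(1) by (auto intro!: image_eqI[where x = "_ / y"])
  \<comment> \<open>The substitution t = y x in Euler's integral for
    \<open>Gamma \<beta>\<close>.\<close>
  ultimately have "(\<lambda>x. \<bar>y\<bar> * ?f (y * x)) absolutely_integrable_on {0..} \<and>
      integral {0..} (\<lambda>x. \<bar>y\<bar> * ?f (y * x)) = Gamma \<beta>"
    using assms(1)
    by (subst has_absolute_integral_change_of_variables_1'[where g = "(*) y"])
       (auto intro!: derivative_eq_intros inj_onI)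
  then have "((\<lambda>x. y * ?f (y * x)) has_integral Gamma \<beta>) {0..}"
    using assms(1) by (simp add: has_integral_iff absolutely_integrable_on_def)
  from has_integral_divide[OF this, of "y powr \<beta>"]
  show ?thesis
  proof (rule has_integral_eq[rotated])
    fix x :: real assume "x \<in> {0..}"
    then show "y * ?f (y * x) / y powr \<beta> = exp (- y * x) * x powr (\<beta> - 1)"
      using assms(1) by (simp add: powr_mult powr_diff exp_minus field_simps)
  qed
qed

text \<open>Up to the factor \<open>Gamma (1 - \<alpha>)\<close> each moment is a Laplace integral;
  summing against the coefficients of \<open>p\<close> puts p(exp(-x)) under the integral
  sign.\<close>

lemma moment_functional_powr_nonneg:
  fixes \<alpha> s :: real
  assumes "\<alpha> < 1" "0 < s" and p: "\<And>x. 0 < x \<Longrightarrow> x < 1 \<Longrightarrow> 0 \<le> poly p x"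
  shows "0 \<le> moment_functional (\<lambda>n. (real n + s) powr (\<alpha> - 1)) p"
proof -
  let ?G = "Gamma (1 - \<alpha>)"
  have "((\<lambda>x. \<Sum>k\<le>degree p. coeff p k * (exp (- (real k + s) * x) * x powr ((1 - \<alpha>) - 1)))
      has_integral (\<Sum>k\<le>degree p. coeff p k * (?G / (real k + s) powr (1 - \<alpha>)))) {0..}"
    using assms by (intro has_integral_sum has_integral_mult_right has_integral_exp_powr) auto
  moreover have "(\<Sum>k\<le>degree p. coeff p k * (exp (- (real k + s) * x) * x powr ((1 - \<alpha>) - 1)))
      = exp (- s * x) * x powr (- \<alpha>) * poly p (exp (- x))" for x :: real
  proof -
    have "exp (- (real k + s) * x) = exp (- s * x) * exp (- x) ^ k" for k
      by (simp add: exp_of_nat_mult[symmetric] exp_add[symmetric] algebra_simps)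
    then show ?thesis by (simp add: poly_altdef sum_distrib_left mult_ac)
  qed
  moreover have "(\<Sum>k\<le>degree p. coeff p k * (?G / (real k + s) powr (1 - \<alpha>)))
      = ?G * moment_functional (\<lambda>n. (real n + s) powr (\<alpha> - 1)) p"
  proof -
    have "?G / (real k + s) powr (1 - \<alpha>) = ?G * (real k + s) powr (\<alpha> - 1)" for k
      by (simp add: divide_inverse flip: powr_minus)
    then show ?thesis by (simp add: moment_functional_def sum_distrib_left mult_ac)
  qed
  ultimately have "((\<lambda>x. exp (- s * x) * x powr (- \<alpha>) * poly p (exp (- x))) has_integral
      ?G * moment_functional (\<lambda>n. (real n + s) powr (\<alpha> - 1)) p) {0..}" by simp
  then have "0 \<le> ?G * moment_functional (\<lambda>n. (real n + s) powr (\<alpha> - 1)) p"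
  proof (rule has_integral_nonneg)
    fix x :: real assume "x \<in> {0..}"
    then show "0 \<le> exp (- s * x) * x powr (- \<alpha>) * poly p (exp (- x))"
      \<comment> \<open>For x > 0 the point exp(-x) lies in (0,1); at x = 0 the integrand vanishes
        since \<open>0 powr (- \<alpha>) = 0\<close>.\<close>
      using p[of "exp (- x)"] by (cases "x = 0") auto
  qed
  then show ?thesis
    using Gamma_real_pos[of "1 - \<alpha>"] assms(1) by (simp add: zero_le_mult_iff not_le[symmetric])
qed

lemma hausdorff_moments_powr_diff:
  fixes \<alpha> :: real
  assumes "0 < \<alpha>" "\<alpha> < 1"
  shows "hausdorff_moments (\<lambda>n. (real n + 1) powr \<alpha> - real n powr \<alpha>)"
proof
  fix p :: "real poly"
  assume p: "\<And>x. 0 < x \<Longrightarrow> x < 1 \<Longrightarrow> 0 \<le> poly p x"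
  define F where "F s = moment_functional (\<lambda>n. (real n + s) powr \<alpha>) p" for s
  have "F 0 \<le> F 1"
  \<comment> \<open>The derivative is taken on the open interval only: at s = 0 the term n = 0 is a
    multiple of s^\<alpha>, continuous but not differentiable there.\<close>
  proof (rule DERIV_nonneg_imp_increasing_open[of 0 1 F])
    fix s :: real assume s: "0 < s" "s < 1"
    have "(F has_real_derivative
        \<alpha> * moment_functional (\<lambda>n. (real n + s) powr (\<alpha> - 1)) p) (at s)"
      unfolding F_def moment_functional_def sum_distrib_left
      by (rule derivative_eq_intros refl | use s in \<open>simp add: mult_ac\<close>)+
    then show "\<exists>y. (F has_real_derivative y) (at s) \<and> 0 \<le> y"
      using moment_functional_powr_nonneg[of \<alpha> s p] assms s p by auto
  next
    show "continuous_on {0..1} F"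
      unfolding F_def moment_functional_def using assms
      by (intro continuous_intros continuous_on_powr') auto
  qed simp
  then show "0 \<le> moment_functional (\<lambda>n. (real n + 1) powr \<alpha> - real n powr \<alpha>) p"
    by (simp add: F_def moment_functional_def algebra_simps sum_subtractf)
qed (use assms in simp)

section \<open>Signs, sum and decay of the inverse coefficients\<close>

theorem lemma3p2:
  fixes \<alpha> :: real
  assumes "0 < \<alpha>" and "\<alpha> < 1"
  shows "omega_inv \<alpha> 0 > 0
    \<and> (\<forall>n\<ge>1. omega_inv \<alpha> n < 0)
    \<and> omega_inv \<alpha> 0 = Gamma (\<alpha> + 1)
    \<and> (\<lambda>n. \<bar>omega_inv \<alpha> (Suc n)\<bar>) sums Gamma (\<alpha> + 1)
    \<and> omega_inv \<alpha> \<in> O(\<lambda>n. real n powr (- \<alpha> - 1))"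
proof -
  define a where "a n = (real n + 1) powr \<alpha> - real n powr \<alpha>" for n
  interpret hausdorff_moments a
    unfolding a_def using assms by (rule hausdorff_moments_powr_diff)
  let ?G = "Gamma (\<alpha> + 1)"
  have G: "0 < ?G" using assms by (intro Gamma_real_pos) auto
  have inv: "omega_inv \<alpha> n = ?G * b n" for n
  proof -
    \<comment> \<open>Factoring out \<open>1 / ?G\<close> normalises the constant coefficient to
      1.\<close>
    have "Abs_fps (omega \<alpha>) = fps_const (1 / ?G) * Abs_fps a"
      by (simp add: fps_eq_iff omega_def a_def)
    then show ?thesis
      using G by (simp add: omega_inv_def b_def fps_inverse_mult fps_const_inverse)
  qed
  have a_pos: "0 < a n" for n
    using assms by (simp add: a_def powr_less_mono2)
  have sum_a: "(\<Sum>k\<le>n. a k) = (real n + 1) powr \<alpha>" for n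
    by (induction n) (auto simp: a_def algebra_simps)
  have r_bound: "r n \<le> (real n + 1) powr (- \<alpha>)" for n
    using r_le[of n] by (simp add: sum_a powr_minus divide_inverse)
  have a_lim: "a \<longlonglongrightarrow> 0"
    unfolding a_def using assms by real_asymp
  have "(\<lambda>n. (real n + 1) powr (- \<alpha>)) \<longlonglongrightarrow> 0"
    using assms by real_asymp
  then have r_lim: "r \<longlonglongrightarrow> 0"
    by (rule tendsto_sandwich[OF _ _ tendsto_const, rotated 2])
       (auto simp: r_bound r_nonneg a_pos)
  have neg: "b n < 0" if "n \<ge> 1" for n
    using b_neg[OF a_lim r_lim that] .
  have bound: "\<bar>b n\<bar> \<le> 2 powr (\<alpha> + 1) * real n powr (- \<alpha> - 1)" if n: "n \<ge> 1" for n
  proof -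
    \<comment> \<open>Cutting at half of n makes both the number of tail terms and
      \<open>?m + 1\<close> at least n/2. The first gives the exponent -1, the second, through the
      bound on \<open>r ?m\<close>, the exponent -\<alpha>.\<close>
    let ?m = "n div 2"
    have m: "real n / 2 \<le> real (n - ?m)" "real n / 2 \<le> real ?m + 1" "?m < n"
      using n by linarith+
    have "real n / 2 * \<bar>b n\<bar> \<le> real (n - ?m) * - b n"
      using m neg[OF n] by (simp add: mult_right_mono_neg)
    also have "\<dots> \<le> r ?m" using m a_pos by (intro b_tail_bound)
    also have "\<dots> \<le> (real ?m + 1) powr (- \<alpha>)" by (rule r_bound)
    also have "\<dots> \<le> (real n / 2) powr (- \<alpha>)"
      using m assms n by (intro powr_mono2') auto
    finally have "\<bar>b n\<bar> \<le> (real n / 2) powr (- \<alpha>) / (real n / 2)"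
      using n by (simp add: field_simps)
    also have "\<dots> = (real n / 2) powr (- \<alpha> - 1)"
      using n by (simp add: powr_diff)
    also have "\<dots> = 2 powr (\<alpha> + 1) * real n powr (- \<alpha> - 1)"
      by (simp add: powr_divide powr_diff powr_minus powr_add field_simps)
    finally show ?thesis .
  qed
  have "omega_inv \<alpha> \<in> O(\<lambda>n. real n powr (- \<alpha> - 1))"
  proof (rule bigoI)
    show "\<forall>\<^sub>F n in sequentially. norm (omega_inv \<alpha> n)
        \<le> ?G * 2 powr (\<alpha> + 1) * norm (real n powr (- \<alpha> - 1))"
      using eventually_ge_at_top[of 1]
      by eventually_elim (use bound G in \<open>simp add: inv abs_mult mult.assoc\<close>)
  qed
  moreover have "(\<lambda>n. \<bar>omega_inv \<alpha> (Suc n)\<bar>) sums ?G"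
  proof -
    have "\<bar>omega_inv \<alpha> (Suc n)\<bar> = ?G * - b (Suc n)" for n
      using neg[of "Suc n"] G by (simp add: inv abs_mult)
    then show ?thesis using sums_mult[OF b_sums[OF r_lim], of ?G] by simp
  qed
  ultimately show ?thesis
    using G neg by (auto simp: inv b_0 mult_pos_neg)
qed

end
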